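(* Let $G$ be a connected bipartite graph with bipartition $(X,Y)$. If $G$ has a $b$-edge consecutive magic labeling, then $b \in \{0,|X|,|Y|,|X|+|Y|\}$.
   Context: Graphs are finite and simple, with vertex set $V(G)$ and edge set $E(G)$. An edge-magic total labeling (also called edge-magic labeling or magic valuation) of $G$ is a bijection $\lambda: V(G)\cup E(G)\to\{1,2,\ldots,|V(G)|+|E(G)|\}$ such that $\lambda(x)+\lambda(y)+\lambda(xy)$ is the same constant (the magic constant of $\lambda$) for all edges $xy\in E(G)$. For an integer $b$ with $0\le b\le |V(G)|$, a $b$-edge consecutive magic labeling of $G$ is an edge-magic total labeling $\lambda$ with $\lambda(E(G))=\{b+1,b+2,\ldots,b+|E(G)|\}$. *)

theory Defs
  imports Main
begin

definition simple_graph :: "'a set \<Rightarrow> 'a set set \<Rightarrow> bool" where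
  "simple_graph V E \<longleftrightarrow>
     finite V \<and> (\<forall>e\<in>E. \<exists>x y. x \<in> V \<and> y \<in> V \<and> x \<noteq> y \<and> e = {x, y})"

text \<open>The graph without vertices counts as connected under this definition.\<close>

definition connected_graph :: "'a set \<Rightarrow> 'a set set \<Rightarrow> bool" where
  "connected_graph V E \<longleftrightarrow>
     simple_graph V E \<and> (\<forall>x\<in>V. \<forall>y\<in>V. (x, y) \<in> {(u, v). {u, v} \<in> E}\<^sup>*)"

definition bipartition :: "'a set \<Rightarrow> 'a set set \<Rightarrow> 'a set \<Rightarrow> 'a set \<Rightarrow> bool" where
  "bipartition V E X Y \<longleftrightarrow>
     X \<union> Y = V \<and> X \<inter> Y = {} \<and> (\<forall>e\<in>E. \<exists>x\<in>X. \<exists>y\<in>Y. e = {x, y})"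

text \<open>A labeling is a function on the disjoint sum of the vertices (\<open>Inl\<close>) and the
  edges (\<open>Inr\<close>).\<close>

definition edge_magic_total_labeling ::
    "'a set \<Rightarrow> 'a set set \<Rightarrow> ('a + 'a set \<Rightarrow> nat) \<Rightarrow> bool" where
  "edge_magic_total_labeling V E f \<longleftrightarrow>
     bij_betw f (V <+> E) {1..card V + card E} \<and>
     (\<exists>k. \<forall>x y. {x, y} \<in> E \<longrightarrow> f (Inl x) + f (Inl y) + f (Inr {x, y}) = k)"

definition edge_consecutive_magic_labeling ::
    "nat \<Rightarrow> 'a set \<Rightarrow> 'a set set \<Rightarrow> ('a + 'a set \<Rightarrow> nat) \<Rightarrow> bool" where
  "edge_consecutive_magic_labeling b V E f \<longleftrightarrow>
     b \<le> card V \<and> edge_magic_total_labeling V E f \<and>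
     f ` Inr ` E = {b + 1..b + card E}"

end

theory Submission
  imports Defs
begin

text \<open>
  Let \<open>n\<close> and \<open>e\<close> be the numbers of vertices and edges, and suppose \<open>0 < b < n\<close>. The vertex
  labels then form two nonempty blocks around the edge labels: the low labels \<open>1, \<dots>, b\<close> and the
  high labels \<open>b + e + 1, \<dots>, n + e\<close>. For an edge, the sum of the two vertex labels is the magic
  constant minus the edge label, so these sums run through an interval of integers, without gaps
  (\<open>endpoint_sum_between\<close>).

  A low-low sum is at most \<open>2b\<close>, a low-high sum lies between \<open>b + e + 2\<close> and \<open>b + n + e\<close>, and a
  high-high sum is at least \<open>2b + 2e + 2\<close>. A connected graph satisfies \<open>n \<le> e + 1\<close>
  (\<open>connected_card_vertices_le\<close>), so \<open>b + e + 1\<close> and \<open>2b + 2e + 1\<close> separate the three ranges and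
  are not sums themselves. Hence all edges are of the same type, and this type is low-high, because
  connectivity forces some edge to join a low vertex to a high one.

  Therefore the low and the high vertices form a bipartition. A connected graph has only one
  bipartition up to exchanging the parts (\<open>connected_bipartition_unique\<close>), so the \<open>b\<close> low vertices
  are exactly \<open>X\<close> or exactly \<open>Y\<close>. The excluded values \<open>b = 0\<close> and \<open>b = n\<close> are the other two
  possibilities in the claim.
\<close>

section \<open>Connected graphs\<close>

lemma simple_graph_edgeE:
  assumes "simple_graph V E" "d \<in> E"
  obtains x y where "x \<in> V" "y \<in> V" "d = {x, y}"
proof -
  have "\<exists>x y. x \<in> V \<and> y \<in> V \<and> x \<noteq> y \<and> d = {x, y}"
    using assms by (simp add: simple_graph_def)
  then show ?thesis
    using that by (elim exE conjE)
qed

lemma simple_graph_finite_edges: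
  assumes "simple_graph V E"
  shows "finite E"
proof -
  have "E \<subseteq> Pow V"
    using assms unfolding simple_graph_def by fastforce
  moreover have "finite (Pow V)"
    using assms unfolding simple_graph_def by simp
  ultimately show ?thesis
    by (rule finite_subset)
qed

lemma simple_graph_edge_vertices:
  assumes "simple_graph V E" "{u, v} \<in> E"
  shows "u \<in> V" "v \<in> V"
proof -
  obtain x y where "x \<in> V" "y \<in> V" "{u, v} = {x, y}"
    by (rule simple_graph_edgeE[OF assms])
  then show "u \<in> V" "v \<in> V"
    by (auto simp: doubleton_eq_iff)
qed

text \<open>A walk from a vertex of \<open>S\<close> to a vertex outside \<open>S\<close> leaves \<open>S\<close> at some step. This is the only
  form in which connectivity enters the other proofs.\<close>

lemma connected_crossing_edge:
  assumes conn: "connected_graph V E" and "S \<subseteq> V" "S \<noteq> {}" "S \<noteq> V"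
  obtains u v where "u \<in> S" "v \<in> V - S" "{u, v} \<in> E"
proof -
  have simple: "simple_graph V E"
    using conn unfolding connected_graph_def by blast
  obtain s where s: "s \<in> S"
    using \<open>S \<noteq> {}\<close> by blast
  obtain t where t: "t \<in> V - S"
    using \<open>S \<subseteq> V\<close> \<open>S \<noteq> V\<close> by blast
  have walk: "(s, t) \<in> {(u, v). {u, v} \<in> E}\<^sup>*"
    using conn s t \<open>S \<subseteq> V\<close> unfolding connected_graph_def by simp (meson subsetD)
  have "\<exists>u\<in>S. \<exists>v\<in>V - S. {u, v} \<in> E"
  proof (rule ccontr)
    assume none: "\<not> ?thesis"
    from walk have "t \<in> S"
    proof (induction rule: rtrancl_induct)
      case base
      show ?case by (rule s)
    next
      case (step y z)
      then have edge: "{y, z} \<in> E"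
        by simp
      then have "z \<in> V"
        by (rule simple_graph_edge_vertices[OF simple])
      then show ?case
        using edge step.IH none by blast
    qed
    with t show False by simp
  qed
  then show ?thesis
    using that by blast
qed

text \<open>Grow a vertex set one vertex at a time along crossing edges: each new vertex brings at least one
  new edge into the set.\<close>

lemma connected_card_vertices_le:
  assumes conn: "connected_graph V E"
  shows "card V \<le> card E + 1"
proof -
  have simple: "simple_graph V E"
    using conn unfolding connected_graph_def by blast
  have finV: "finite V"
    using simple unfolding simple_graph_def by blast
  have finE: "finite E"
    by (rule simple_graph_finite_edges[OF simple])
  have grow: "\<exists>S\<subseteq>V. card S = k \<and> k \<le> card {d \<in> E. d \<subseteq> S} + 1" if "k \<le> card V" for k
    using that
  proof (induction k)
    case 0
    show ?case by (rule exI[of _ "{}"]) simp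
  next
    case (Suc k)
    then obtain S where S: "S \<subseteq> V" "card S = k" "k \<le> card {d \<in> E. d \<subseteq> S} + 1"
      by auto
    show ?case
    proof (cases "S = {}")
      case True
      from Suc.prems obtain v where "v \<in> V"
        by (metis card.empty ex_in_conv not_less_eq_eq zero_le)
      then show ?thesis
        using S True by (intro exI[of _ "{v}"]) auto
    next
      case False
      have "S \<noteq> V"
        using S(2) Suc.prems by auto
      then obtain u v where uv: "u \<in> S" "v \<in> V - S" "{u, v} \<in> E"
        using connected_crossing_edge[OF conn S(1) False] by blast
      have finS: "finite S"
        using S(1) finV by (rule finite_subset)
      have "Suc (card {d \<in> E. d \<subseteq> S}) = card (insert {u, v} {d \<in> E. d \<subseteq> S})"
        using uv finE by simp
      also have "\<dots> \<le> card {d \<in> E. d \<subseteq> insert v S}"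
        using uv finE by (intro card_mono) auto
      finally show ?thesis
        using S uv finS by (intro exI[of _ "insert v S"]) auto
    qed
  qed
  then obtain S where S: "S \<subseteq> V" "card S = card V" "card V \<le> card {d \<in> E. d \<subseteq> S} + 1"
    by blast
  have "card {d \<in> E. d \<subseteq> S} \<le> card E"
    using finE by (intro card_mono) auto
  with S(3) show ?thesis by linarith
qed

text \<open>For two bipartitions \<open>(X, Y)\<close> and \<open>(L, H)\<close>, an edge changes both its \<open>X/Y\<close> side and its
  \<open>L/H\<close> side, so no edge leaves the set \<open>(X \<inter> L) \<union> (Y \<inter> H)\<close> on which the two agree. By
  connectivity they agree everywhere or nowhere.\<close>

lemma connected_bipartition_unique:
  assumes conn: "connected_graph V E"
    and XY: "bipartition V E X Y" and LH: "bipartition V E L H"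
  shows "L = X \<or> L = Y"
proof -
  let ?S = "(X \<inter> L) \<union> (Y \<inter> H)"
  have parts: "X \<union> Y = V" "X \<inter> Y = {}" "L \<union> H = V" "L \<inter> H = {}"
    using XY LH unfolding bipartition_def by blast+
  have "?S = {} \<or> ?S = V"
  proof (rule ccontr)
    assume "\<not> ?thesis"
    moreover have "?S \<subseteq> V"
      using parts by blast
    ultimately obtain u v where uv: "u \<in> ?S" "v \<in> V - ?S" "{u, v} \<in> E"
      using connected_crossing_edge[OF conn] by metis
    obtain x y where xy: "x \<in> X" "y \<in> Y" "{u, v} = {x, y}"
      using XY uv(3) unfolding bipartition_def by blast
    obtain l h where lh: "l \<in> L" "h \<in> H" "{u, v} = {l, h}"
      using LH uv(3) unfolding bipartition_def by blast
    have "u \<in> X \<and> v \<in> Y \<or> u \<in> Y \<and> v \<in> X"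
      using xy by (auto simp: doubleton_eq_iff)
    moreover have "u \<in> L \<and> v \<in> H \<or> u \<in> H \<and> v \<in> L"
      using lh by (auto simp: doubleton_eq_iff)
    ultimately show False
      using uv(1,2) parts by blast
  qed
  then show ?thesis
  proof
    assume "?S = {}"
    then have "L = Y"
      using parts by auto
    then show ?thesis ..
  next
    assume "?S = V"
    then have "L = X"
      using parts by auto
    then show ?thesis ..
  qed
qed

section \<open>Labels of vertices and edges\<close>

lemma edge_consecutive_vertex_labels:
  assumes "edge_consecutive_magic_labeling b V E f"
  shows "f ` Inl ` V = {1..b} \<union> {b + card E + 1..card V + card E}"
proof -
  have b: "b \<le> card V"
    and bij: "bij_betw f (V <+> E) {1..card V + card E}"
    and edges: "f ` Inr ` E = {b + 1..b + card E}"
    using assms unfolding edge_consecutive_magic_labeling_def edge_magic_total_labeling_def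
    by blast+
  have "f ` Inl ` V = f ` ((V <+> E) - Inr ` E)"
    by (rule arg_cong[of _ _ "image f"]) auto
  also have "\<dots> = f ` (V <+> E) - f ` Inr ` E"
    using bij by (intro inj_on_image_set_diff[of _ "V <+> E"]) (auto simp: bij_betw_def)
  also have "\<dots> = {1..card V + card E} - {b + 1..b + card E}"
    using bij edges by (simp add: bij_betw_def)
  also have "\<dots> = {1..b} \<union> {b + card E + 1..card V + card E}"
    using b by auto
  finally show ?thesis .
qed

lemma edge_consecutive_card_low_vertices:
  assumes lab: "edge_consecutive_magic_labeling b V E f"
  shows "card {v \<in> V. f (Inl v) \<le> b} = b"
proof -
  have inj: "inj_on f (V <+> E)"
    using lab unfolding edge_consecutive_magic_labeling_def edge_magic_total_labeling_def
      bij_betw_def by blast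
  have "inj_on (\<lambda>v. f (Inl v)) {v \<in> V. f (Inl v) \<le> b}"
    using inj by (auto simp: inj_on_def)
  then have "card ((\<lambda>v. f (Inl v)) ` {v \<in> V. f (Inl v) \<le> b}) = card {v \<in> V. f (Inl v) \<le> b}"
    by (rule card_image)
  moreover have "(\<lambda>v. f (Inl v)) ` {v \<in> V. f (Inl v) \<le> b} = f ` Inl ` V \<inter> {..b}"
    by auto
  moreover have "\<dots> = {1..b}"
    unfolding edge_consecutive_vertex_labels[OF lab] by auto
  ultimately show ?thesis
    by simp
qed

text \<open>The magic property turns the interval of edge labels upside down, so the endpoint sums also
  form an interval.\<close>

lemma endpoint_sum_between:
  assumes simple: "simple_graph V E" and lab: "edge_consecutive_magic_labeling b V E f"
    and uv: "{u, v} \<in> E" and xy: "{x, y} \<in> E"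
    and lower: "f (Inl u) + f (Inl v) \<le> t" and upper: "t \<le> f (Inl x) + f (Inl y)"
  obtains p q where "{p, q} \<in> E" "f (Inl p) + f (Inl q) = t"
proof -
  have edges: "f ` Inr ` E = {b + 1..b + card E}"
    using lab unfolding edge_consecutive_magic_labeling_def by blast
  obtain k where magic: "\<And>x y. {x, y} \<in> E \<Longrightarrow> f (Inl x) + f (Inl y) + f (Inr {x, y}) = k"
    using lab unfolding edge_consecutive_magic_labeling_def edge_magic_total_labeling_def
    by (elim conjE exE) simp
  have "f (Inr {u, v}) \<in> {b + 1..b + card E}" "f (Inr {x, y}) \<in> {b + 1..b + card E}"
    unfolding edges[symmetric] by (rule imageI[OF imageI[OF uv]], rule imageI[OF imageI[OF xy]])
  then have "k - t \<in> {b + 1..b + card E}" and tk: "t \<le> k"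
    using magic[OF uv] magic[OF xy] lower upper by auto
  then obtain d where d: "d \<in> E" "f (Inr d) = k - t"
    using edges by (metis imageE)
  obtain p q where pq: "d = {p, q}"
    by (rule simple_graph_edgeE[OF simple d(1)])
  have "f (Inl p) + f (Inl q) = t"
    using magic[of p q] d pq tk by simp
  then show ?thesis
    using that[of p q] d(1) pq by simp
qed

section \<open>The possible positions of the edge labels\<close>

text \<open>Both blocks of vertex labels are nonempty, so connectivity provides a low-high edge. A low-low or
  high-high edge would have its sum on the other side of a separating value, which would then itself
  be a sum because sums have no gaps.\<close>

lemma low_high_bipartition:
  assumes conn: "connected_graph V E" and lab: "edge_consecutive_magic_labeling b V E f"
    and "0 < b" "b < card V"
  shows "bipartition V E {v \<in> V. f (Inl v) \<le> b} {v \<in> V. b < f (Inl v)}"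
proof -
  define g where "g v = f (Inl v)" for v
  define L where "L = {v \<in> V. g v \<le> b}"
  define e where "e = card E"
  have simple: "simple_graph V E"
    using conn unfolding connected_graph_def by blast
  have size: "card V \<le> e + 1"
    unfolding e_def by (rule connected_card_vertices_le[OF conn])
  have labels: "g v \<le> b \<or> b + e + 1 \<le> g v" "g v \<le> card V + e" if "v \<in> V" for v
  proof -
    have "g v \<in> f ` Inl ` V"
      using that by (auto simp: g_def)
    then have "g v \<in> {1..b} \<union> {b + e + 1..card V + e}"
      unfolding edge_consecutive_vertex_labels[OF lab] e_def .
    then show "g v \<le> b \<or> b + e + 1 \<le> g v" "g v \<le> card V + e"
      using \<open>b < card V\<close> by auto
  qed
  have positive: "1 \<le> g v" if "v \<in> V" for v
  proof -
    have "g v \<in> f ` Inl ` V"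
      using that by (auto simp: g_def)
    then show ?thesis
      unfolding edge_consecutive_vertex_labels[OF lab] by auto
  qed
  have card_L: "card L = b"
    using edge_consecutive_card_low_vertices[OF lab] unfolding L_def g_def .
  have "L \<subseteq> V"
    by (auto simp: L_def)
  moreover have "L \<noteq> {}" "L \<noteq> V"
    using card_L \<open>0 < b\<close> \<open>b < card V\<close> by auto
  ultimately obtain u v where uv: "u \<in> L" "v \<in> V - L" "{u, v} \<in> E"
    using connected_crossing_edge[OF conn] by blast
  then have u: "1 \<le> g u" "g u \<le> b" and v: "b + e + 1 \<le> g v" "g v \<le> card V + e"
    using positive labels[of v] by (auto simp: L_def)
  \<comment> \<open>The two values separating low-low, low-high and high-high sums are not sums of an edge.\<close>
  have no_sum: "g p + g q \<noteq> b + e + 1" "g p + g q \<noteq> 2 * b + 2 * e + 1"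
    if "{p, q} \<in> E" for p q
    using simple_graph_edge_vertices[OF simple that] labels[of p] labels[of q]
      positive[of p] positive[of q] size \<open>0 < b\<close> \<open>b < card V\<close> by linarith+
  have mixed: "p \<in> L \<longleftrightarrow> q \<notin> L" if pq: "{p, q} \<in> E" for p q
  proof -
    have V: "p \<in> V" "q \<in> V"
      using simple_graph_edge_vertices[OF simple pq] by blast+
    have "\<not> (p \<in> L \<and> q \<in> L)"
    proof
      assume "p \<in> L \<and> q \<in> L"
      then have "g p + g q \<le> b + e + 1" "b + e + 1 \<le> g u + g v"
        using size \<open>b < card V\<close> u v by (auto simp: L_def)
      then obtain r s where "{r, s} \<in> E" "g r + g s = b + e + 1"
        using endpoint_sum_between[OF simple lab pq uv(3)] unfolding g_def by metis
      then show False
        using no_sum(1) by blast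
    qed
    moreover have "\<not> (p \<notin> L \<and> q \<notin> L)"
    proof
      assume "p \<notin> L \<and> q \<notin> L"
      then have "2 * b + 2 * e + 1 \<le> g p + g q"
        using V labels[of p] labels[of q] by (auto simp: L_def)
      moreover have "g u + g v \<le> 2 * b + 2 * e + 1"
        using size u v by linarith
      ultimately obtain r s where "{r, s} \<in> E" "g r + g s = 2 * b + 2 * e + 1"
        using endpoint_sum_between[OF simple lab uv(3) pq] unfolding g_def by metis
      then show False
        using no_sum(2) by blast
    qed
    ultimately show ?thesis by blast
  qed
  have high: "{v \<in> V. b < f (Inl v)} = V - L"
    by (auto simp: L_def g_def)
  have "\<exists>x\<in>L. \<exists>y\<in>V - L. d = {x, y}" if "d \<in> E" for d
  proof -
    obtain p q where pq: "d = {p, q}" "p \<in> V" "q \<in> V"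
      by (rule simple_graph_edgeE[OF simple \<open>d \<in> E\<close>])
    show ?thesis
    proof (cases "p \<in> L")
      case True
      then show ?thesis
        using mixed[of p q] that pq by blast
    next
      case False
      moreover have "q \<in> L"
        using False mixed[of p q] that pq by blast
      moreover have "d = {q, p}"
        using pq by blast
      ultimately show ?thesis
        using pq(2) by blast
    qed
  qed
  then have "bipartition V E L (V - L)"
    using \<open>L \<subseteq> V\<close> unfolding bipartition_def by blast
  then show ?thesis
    unfolding high by (simp add: L_def g_def)
qed

theorem theorem2:
  fixes V X Y :: "'a set" and E :: "'a set set" and b :: nat
  assumes "connected_graph V E"
    and "bipartition V E X Y"
    and "\<exists>f. edge_consecutive_magic_labeling b V E f"
  shows "b \<in> {0, card X, card Y, card X + card Y}"
proof -
  obtain f where lab: "edge_consecutive_magic_labeling b V E f"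
    using assms(3) by blast
  have "finite V"
    using assms(1) unfolding connected_graph_def simple_graph_def by blast
  then have card_V: "card V = card X + card Y"
    using assms(2) unfolding bipartition_def by (metis card_Un_disjoint finite_Un)
  have "b \<le> card V"
    using lab unfolding edge_consecutive_magic_labeling_def by blast
  then consider "b = 0" | "b = card V" | "0 < b" "b < card V"
    by linarith
  then show ?thesis
  proof cases
    case 3
    let ?L = "{v \<in> V. f (Inl v) \<le> b}"
    have "?L = X \<or> ?L = Y"
      using connected_bipartition_unique[OF assms(1,2) low_high_bipartition[OF assms(1) lab 3]] .
    then have "b = card X \<or> b = card Y"
      using edge_consecutive_card_low_vertices[OF lab] by metis
    then show ?thesis by blast
  qed (simp_all add: card_V)
qed

end
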